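(* Let $N\ge3$, let $p>\frac{N+2}{N-2}$ and $0<\beta<\frac{2}{p-1}$, and let $\Omega\subset\mathbb{R}^N$ be a ball with outward unit normal $\nu$ on $\partial\Omega$. Then the problem $$-\Delta u=u^p \ \text{ in }\Omega,\qquad u>0\ \text{ in }\Omega,\qquad \frac{\partial u}{\partial\nu}+\beta u=0\ \text{ on }\partial\Omega$$ admits a radial positive solution.
   Context: Radial means radially symmetric about the center of the ball. Solutions are understood in the classical sense, $u\in C^2(\Omega)\cap C^1(\overline\Omega)$.
   Formalization: For a ball of radius R the condition 0<β<2/(p−1) is replaced by its scale-invariant form β>0, βR<2/(p−1) (identical when R=1), since the claim fails for large balls, e.g. N=3, p=7, β=1/6, R=6. *)

theory Defs
  imports "HOL-Analysis.Analysis"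
begin

text \<open>
  Derivatives are taken relative to a set \<open>S\<close>, so that the same notions serve an open domain,
  where \<open>at x within S\<close> is \<open>at x\<close>, and the closure of a ball, where they give the one-sided
  derivative at boundary points. In both cases the derivative is unique, so \<open>frechet_derivative\<close>
  picks a determined value at every point of \<open>S\<close> where the function is differentiable.
\<close>

definition dir_deriv ::
    "'a::euclidean_space set \<Rightarrow> ('a \<Rightarrow> real) \<Rightarrow> 'a \<Rightarrow> 'a \<Rightarrow> real" where
  "dir_deriv S u v x = frechet_derivative u (at x within S) v"

definition C1_on :: "'a::euclidean_space set \<Rightarrow> ('a \<Rightarrow> real) \<Rightarrow> bool" where
  "C1_on S u \<longleftrightarrow>
     u differentiable_on S \<and> (\<forall>b\<in>Basis. continuous_on S (dir_deriv S u b))"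

definition C2_on :: "'a::euclidean_space set \<Rightarrow> ('a \<Rightarrow> real) \<Rightarrow> bool" where
  "C2_on S u \<longleftrightarrow> C1_on S u \<and> (\<forall>b\<in>Basis. C1_on S (dir_deriv S u b))"

definition laplacian :: "'a::euclidean_space set \<Rightarrow> ('a \<Rightarrow> real) \<Rightarrow> 'a \<Rightarrow> real" where
  "laplacian S u x = (\<Sum>b\<in>Basis. dir_deriv S (dir_deriv S u b) b x)"

definition outward_normal_ball :: "'a::euclidean_space \<Rightarrow> real \<Rightarrow> 'a \<Rightarrow> 'a" where
  "outward_normal_ball c R x = (1 / R) *\<^sub>R (x - c)"

text \<open>
  A classical positive solution of \<open>-\<Delta>u = u\<^sup>p\<close> in \<open>\<Omega>\<close> with the Robin condition
  \<open>\<partial>u/\<partial>\<nu> + \<beta> u = 0\<close> on the boundary; \<open>\<nu>\<close> is the outward unit normal field.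
  Values of \<open>u\<close> outside the closure of \<open>\<Omega>\<close> play no role.
\<close>

definition positive_robin_solution ::
    "'a::euclidean_space set \<Rightarrow> ('a \<Rightarrow> 'a) \<Rightarrow> real \<Rightarrow> real \<Rightarrow> ('a \<Rightarrow> real) \<Rightarrow> bool" where
  "positive_robin_solution \<Omega> \<nu> p \<beta> u \<longleftrightarrow>
     C2_on \<Omega> u \<and> C1_on (closure \<Omega>) u \<and>
     (\<forall>x\<in>\<Omega>. - laplacian \<Omega> u x = u x powr p) \<and>
     (\<forall>x\<in>\<Omega>. 0 < u x) \<and>
     (\<forall>x\<in>frontier \<Omega>. dir_deriv (closure \<Omega>) u (\<nu> x) x + \<beta> * u x = 0)"

definition radial_on :: "'a::euclidean_space set \<Rightarrow> 'a \<Rightarrow> ('a \<Rightarrow> real) \<Rightarrow> bool" where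
  "radial_on S c u \<longleftrightarrow> (\<exists>g. \<forall>x\<in>S. u x = g (norm (x - c)))"

end

theory Submission
  imports Defs
begin

text \<open>
  Write a radial function as a function \<open>g\<close> of the squared distance to the centre. In dimension \<open>N\<close>
  the equation \<open>-\<Delta>u = u\<^sup>p\<close> with \<open>u = 1\<close> at the centre becomes
  \[ g(s) = 1 - \frac12 \int_0^s q, \qquad q(t) = \int_0^1 \tau^{N-1} g(t\tau^2)^p \, d\tau , \]
  and the Robin condition with coefficient \<open>\<beta>\<close> on the sphere of radius \<open>R\<close>, after rescaling that
  sphere to \<open>s = S\<close>, becomes \<open>S * q S = b * g S\<close> with \<open>b = \<beta> * R\<close>. The initial value problem, with the
  power cut off to a globally Lipschitz function, is solved on the half-line by Picard iteration
  (\<open>radial_ivp_solution\<close>).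

  It remains to find \<open>S\<close>, with \<open>g\<close> positive on \<open>{0..S}\<close>. The quotient \<open>s * q s / g s\<close> vanishes at 0,
  so by continuity it is enough that it cannot remain below \<open>b\<close> forever. A quotient below \<open>b\<close> means
  that \<open>g\<close> decays no faster than \<open>s powr - (b / 2)\<close>; but \<open>g\<close> is decreasing, so \<open>q s \<ge> g s powr p / N\<close>,
  and the quotient is at least \<open>s * g s powr (p - 1) / N\<close>, which grows like a positive power of \<open>s\<close>
  because \<open>b < 2 / (p - 1)\<close>. This contradiction (\<open>shooting\<close>) also covers profiles that would reach zero
  at a finite point, since \<open>g\<close> is positive for as long as the quotient is below \<open>b\<close>.

  On \<open>{0..S}\<close> the cut-off is inactive, \<open>q\<close> is continuously differentiable and
  \<open>N * q s + 2 * s * q' s = g s powr p\<close> (\<open>radial_average_smooth\<close>). Rescaling to the given ball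
  (\<open>radial_solution_of_profile\<close>) gives the solution.
\<close>

section \<open>Weighted radial averages\<close>

text \<open>
  If \<open>h\<close> gives a radial function as a function of the squared distance to the centre, then
  \<open>(m + 1) * radial_average m h s\<close> is its mean over the ball of radius \<open>sqrt s\<close> in dimension
  \<open>m + 1\<close>. Rescaling the ball to the unit ball absorbs the singular weight
  \<open>s powr (- (m + 1) / 2)\<close>, so that nothing degenerates at \<open>s = 0\<close>.
\<close>

definition radial_average :: "nat \<Rightarrow> (real \<Rightarrow> real) \<Rightarrow> real \<Rightarrow> real" where
  "radial_average m h s = integral {0..1} (\<lambda>\<tau>. \<tau> ^ m * h (s * \<tau>\<^sup>2))"

lemma scaled_argument_le:
  fixes s \<tau> :: real
  assumes "0 \<le> s" "0 \<le> \<tau>" "\<tau> \<le> 1"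
  shows "0 \<le> s * \<tau>\<^sup>2" "s * \<tau>\<^sup>2 \<le> s"
  using assms by (auto intro!: mult_left_le power_le_one)

lemma radial_average_integrand_continuous:
  fixes s :: real
  assumes "continuous_on {0..s} h" "0 \<le> s"
  shows "continuous_on {0..1} (\<lambda>\<tau>. \<tau> ^ m * h (s * \<tau>\<^sup>2))"
  using assms scaled_argument_le[of s]
  by (intro continuous_intros continuous_on_compose2[OF assms(1)]) auto

lemma radial_average_continuous:
  assumes "continuous_on {0..T} h"
  shows "continuous_on {0..T} (radial_average m h)"
proof -
  have "continuous_on ({0..T} \<times> cbox 0 1) (\<lambda>(s, \<tau>). \<tau> ^ m * h (s * \<tau>\<^sup>2))"
    unfolding split_def
  proof (intro continuous_intros continuous_on_compose2[OF assms])
    show "(\<lambda>x. fst x * (snd x)\<^sup>2) ` ({0..T} \<times> cbox 0 1) \<subseteq> {0..T}"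
      using scaled_argument_le by fastforce
  qed
  from integral_continuous_on_param[OF this] show ?thesis
    by (simp add: radial_average_def[abs_def])
qed

lemma integral_unit_power: "integral {0..1} (\<lambda>\<tau>::real. \<tau> ^ m) = 1 / (real m + 1)"
proof -
  have "((\<lambda>\<tau>::real. \<tau> ^ m) has_integral (1 ^ Suc m / (real m + 1) - 0 ^ Suc m / (real m + 1))) {0..1}"
    by (rule fundamental_theorem_of_calculus)
       (auto intro!: derivative_eq_intros simp del: power_Suc
         simp: add.commute simp flip: has_real_derivative_iff_has_vector_derivative)
  then show ?thesis by (simp add: integral_unique)
qed

lemma radial_average_ge:
  assumes "continuous_on {0..s} h" "0 \<le> s" "\<And>t. t \<in> {0..s} \<Longrightarrow> B \<le> h t"
  shows "B / (real m + 1) \<le> radial_average m h s"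
proof -
  have "integral {0..1} (\<lambda>\<tau>::real. \<tau> ^ m * B) \<le> radial_average m h s"
    unfolding radial_average_def using assms scaled_argument_le[of s]
    by (intro integral_le integrable_continuous_real radial_average_integrand_continuous)
       (auto intro!: continuous_intros mult_left_mono)
  then show ?thesis by (simp add: integral_unit_power)
qed

lemma radial_average_minus: "radial_average m (\<lambda>t. - h t) s = - radial_average m h s"
  by (simp add: radial_average_def)

lemma radial_average_diff:
  assumes "continuous_on {0..s} h" "continuous_on {0..s} k" "0 \<le> s"
  shows "radial_average m h s - radial_average m k s = radial_average m (\<lambda>t. h t - k t) s"
  unfolding radial_average_def right_diff_distrib using assms
  by (intro integral_diff[symmetric] integrable_continuous_real radial_average_integrand_continuous)

lemma radial_average_abs_le:
  assumes "continuous_on {0..s} h" "0 \<le> s" "\<And>t. t \<in> {0..s} \<Longrightarrow> \<bar>h t\<bar> \<le> B"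
  shows "\<bar>radial_average m h s\<bar> \<le> B"
proof -
  have B: "0 \<le> B" using assms(2) assms(3)[of 0] by force
  have 1: "- B / (real m + 1) \<le> radial_average m h s"
    using assms by (intro radial_average_ge) (auto simp: abs_le_iff minus_le_iff)
  have 2: "- B / (real m + 1) \<le> radial_average m (\<lambda>t. - h t) s"
    using assms by (intro radial_average_ge) (auto intro!: continuous_intros simp: abs_le_iff)
  have "B / (real m + 1) \<le> B" using B by (simp add: divide_le_eq mult_left_mono distrib_left)
  with 1 2 show ?thesis unfolding radial_average_minus by (simp add: abs_le_iff)
qed

text \<open>
  The derivative of the average comes from differentiating under the integral sign. The identity
  is the radial divergence theorem in the variable \<open>s\<close>: the left-hand side is the integral over
  \<open>{0..1}\<close> of the \<open>\<tau>\<close>-derivative of \<open>\<tau> ^ (m + 1) * h (s * \<tau>\<^sup>2)\<close>. It turns the integral equation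
  for the profile into the differential equation, including at \<open>s = 0\<close>.
\<close>

lemma radial_average_smooth:
  fixes h h' :: "real \<Rightarrow> real" and m :: nat
  assumes S: "0 < S"
    and der: "\<And>s. s \<in> {0..S} \<Longrightarrow> (h has_real_derivative h' s) (at s within {0..S})"
    and cont: "continuous_on {0..S} h'"
  defines "q' \<equiv> radial_average (m + 2) h'"
  shows "s \<in> {0..S} \<Longrightarrow> (radial_average m h has_real_derivative q' s) (at s within {0..S})"
    and "continuous_on {0..S} q'"
    and "s \<in> {0..S} \<Longrightarrow> (real m + 1) * radial_average m h s + 2 * s * q' s = h s"
proof -
  have conth: "continuous_on {0..S} h"
    using der by (meson DERIV_continuous continuous_on_eq_continuous_within)
  show "continuous_on {0..S} q'"
    unfolding q'_def by (intro radial_average_continuous cont)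
  have chain: "((\<lambda>s. h (f s)) has_real_derivative h' (f s) * f') (at s within A)"
    if "(f has_real_derivative f') (at s within A)" "f ` A \<subseteq> {0..S}" "s \<in> A" for f f' s A
  proof -
    have "(h has_real_derivative h' (f s)) (at (f s) within f ` A)"
      using has_field_derivative_subset[OF der that(2)] that(2,3) by blast
    from DERIV_image_chain[OF this that(1)] show ?thesis by (simp add: o_def)
  qed
  show "(radial_average m h has_real_derivative q' s) (at s within {0..S})" if s: "s \<in> {0..S}"
  proof -
    have "((\<lambda>s. integral (cbox 0 1) (\<lambda>\<tau>. \<tau> ^ m * h (s * \<tau>\<^sup>2))) has_real_derivative
        integral (cbox 0 1) (\<lambda>\<tau>. \<tau> ^ (m + 2) * h' (s * \<tau>\<^sup>2))) (at s within {0..S})"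
    proof (rule leibniz_rule_field_derivative[where fx = "\<lambda>s \<tau>. \<tau> ^ (m + 2) * h' (s * \<tau>\<^sup>2)"])
      fix x t :: real assume x: "x \<in> {0..S}" and t: "t \<in> cbox 0 1"
      have "((\<lambda>x. h (x * t\<^sup>2)) has_real_derivative h' (x * t\<^sup>2) * (1 * t\<^sup>2)) (at x within {0..S})"
        using x t scaled_argument_le[of _ t]
        by (intro chain DERIV_cmult_right DERIV_ident) fastforce+
      then show "((\<lambda>x. t ^ m * h (x * t\<^sup>2)) has_real_derivative t ^ (m + 2) * h' (x * t\<^sup>2))
          (at x within {0..S})"
        by (auto intro!: derivative_eq_intros simp: power_add power2_eq_square)
    next
      fix x assume "x \<in> {0..S}"
      then show "(\<lambda>\<tau>. \<tau> ^ m * h (x * \<tau>\<^sup>2)) integrable_on cbox 0 1"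
        by (auto intro!: integrable_continuous_real radial_average_integrand_continuous
            intro: continuous_on_subset[OF conth])
    next
      show "continuous_on ({0..S} \<times> cbox 0 1) (\<lambda>(s, \<tau>). \<tau> ^ (m + 2) * h' (s * \<tau>\<^sup>2))"
        unfolding split_def
      proof (intro continuous_intros continuous_on_compose2[OF cont])
        show "(\<lambda>x. fst x * (snd x)\<^sup>2) ` ({0..S} \<times> cbox 0 1) \<subseteq> {0..S}"
          using scaled_argument_le by fastforce
      qed
    qed (use s in auto)
    then show ?thesis by (simp add: radial_average_def[abs_def] q'_def)
  qed
  show "(real m + 1) * radial_average m h s + 2 * s * q' s = h s" if s: "s \<in> {0..S}"
  proof -
    have sub: "(\<lambda>\<tau>. s * \<tau>\<^sup>2) ` {0..1} \<subseteq> {0..S}"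
      using s scaled_argument_le[of s] by fastforce
    have int: "((\<lambda>\<tau>. \<tau> ^ k * f (s * \<tau>\<^sup>2)) has_integral radial_average k f s) {0..1}"
      if "continuous_on {0..S} f" for k f
      unfolding radial_average_def using s that
      by (intro integrable_integral integrable_continuous_real radial_average_integrand_continuous)
         (auto intro: continuous_on_subset)
    have "((\<lambda>\<tau>. (real m + 1) * (\<tau> ^ m * h (s * \<tau>\<^sup>2)) + 2 * s * (\<tau> ^ (m + 2) * h' (s * \<tau>\<^sup>2)))
        has_integral (1 ^ Suc m * h (s * 1\<^sup>2) - 0 ^ Suc m * h (s * 0\<^sup>2))) {0..1}"
    proof (rule fundamental_theorem_of_calculus)
      fix x :: real assume x: "x \<in> {0..1}"
      have "((\<lambda>\<tau>. s * \<tau>\<^sup>2) has_real_derivative s * (2 * x)) (at x within {0..1})"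
        by (auto intro!: derivative_eq_intros)
      from chain[OF this sub x]
      have "((\<lambda>\<tau>. \<tau> ^ Suc m * h (s * \<tau>\<^sup>2)) has_real_derivative
          (real m + 1) * (x ^ m * h (s * x\<^sup>2)) + 2 * s * (x ^ (m + 2) * h' (s * x\<^sup>2)))
          (at x within {0..1})"
        by (auto intro!: derivative_eq_intros simp del: power_Suc simp: algebra_simps power2_eq_square)
           (simp add: algebra_simps)
      then show "((\<lambda>\<tau>. \<tau> ^ Suc m * h (s * \<tau>\<^sup>2)) has_vector_derivative
          (real m + 1) * (x ^ m * h (s * x\<^sup>2)) + 2 * s * (x ^ (m + 2) * h' (s * x\<^sup>2)))
          (at x within {0..1})"
        by (simp add: has_real_derivative_iff_has_vector_derivative)
    qed simp
    moreover have "((\<lambda>\<tau>. (real m + 1) * (\<tau> ^ m * h (s * \<tau>\<^sup>2)) + 2 * s * (\<tau> ^ (m + 2) * h' (s * \<tau>\<^sup>2)))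
        has_integral ((real m + 1) * radial_average m h s + 2 * s * q' s)) {0..1}"
      unfolding q'_def by (intro has_integral_add has_integral_mult_right int conth cont)
    ultimately show ?thesis
      by (auto dest: has_integral_unique)
  qed
qed

section \<open>Global solvability of the radial initial value problem\<close>

text \<open>
  Its continuous fixed points \<open>g\<close> on the half-line are the solutions of \<open>g' = - q / 2\<close>,
  \<open>g 0 = 1\<close>, where \<open>q\<close> is the average of \<open>f \<circ> g\<close>. For such \<open>g\<close> the function \<open>g (norm x ^ 2)\<close> is a radial solution of \<open>-\<Delta>u = f u\<close> in
  dimension \<open>m + 1\<close> with \<open>u 0 = 1\<close>.
\<close>

definition picard_step :: "nat \<Rightarrow> (real \<Rightarrow> real) \<Rightarrow> (real \<Rightarrow> real) \<Rightarrow> real \<Rightarrow> real" where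
  "picard_step m f g s = 1 - integral {0..s} (radial_average m (\<lambda>t. f (g t))) / 2"

context
  fixes m :: nat and f :: "real \<Rightarrow> real" and L :: real
  assumes lip: "\<And>x y. \<bar>f x - f y\<bar> \<le> L * \<bar>x - y\<bar>"
begin

lemma lipschitz_nonneg: "0 \<le> L"
  using lip[of 1 0] by simp

lemma lipschitz_continuous: "continuous_on UNIV f"
proof -
  have "L-lipschitz_on UNIV f"
    using lip lipschitz_nonneg by (auto simp: lipschitz_on_def dist_real_def)
  then show ?thesis by (rule lipschitz_on_continuous_on)
qed

lemma continuous_on_nonlinearity:
  "continuous_on A g \<Longrightarrow> continuous_on A (\<lambda>t. f (g t))"
  by (rule continuous_on_compose2[OF lipschitz_continuous]) auto

lemma picard_step_continuous:
  assumes "continuous_on {0..T} g"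
  shows "continuous_on {0..T} (picard_step m f g)"
  unfolding picard_step_def[abs_def]
  by (intro continuous_intros indefinite_integral_continuous_1 integrable_continuous_real
        radial_average_continuous continuous_on_nonlinearity assms) auto

text \<open>
  Averaging does not increase a bound that is monotone in \<open>s\<close>, so each step integrates a bound on
  \<open>L * \<bar>g - h\<bar>\<close>. Stating it with a bounding function \<open>B\<close> serves both the factorial decay of the
  iterates (\<open>B\<close> a monomial) and the continuity of the step (\<open>B\<close> constant).
\<close>

lemma picard_step_diff_le:
  assumes g: "continuous_on {0..s} g" and h: "continuous_on {0..s} h" and s: "0 \<le> s"
    and B: "(B has_integral I) {0..s}"
    and le: "\<And>t t'. 0 \<le> t' \<Longrightarrow> t' \<le> t \<Longrightarrow> t \<le> s \<Longrightarrow> L * \<bar>g t' - h t'\<bar> \<le> B t"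
  shows "\<bar>picard_step m f g s - picard_step m f h s\<bar> \<le> I"
proof -
  define a where "a g = radial_average m (\<lambda>t. f (g t))" for g
  have int: "a g integrable_on {0..s}" "a h integrable_on {0..s}"
    unfolding a_def using g h
    by (auto intro!: integrable_continuous_real radial_average_continuous continuous_on_nonlinearity)
  have "\<bar>a g t - a h t\<bar> \<le> B t" if t: "t \<in> {0..s}" for t
  proof -
    have c: "continuous_on {0..t} g" "continuous_on {0..t} h"
      using t by (auto intro: continuous_on_subset[OF g] continuous_on_subset[OF h])
    have "\<bar>f (g t') - f (h t')\<bar> \<le> B t" if "t' \<in> {0..t}" for t'
      using lip[of "g t'" "h t'"] le[of t' t] t that by auto
    then show ?thesis
      unfolding a_def using t c
      by (subst radial_average_diff)
         (auto intro!: radial_average_abs_le continuous_intros continuous_on_nonlinearity)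
  qed
  then have "norm (integral {0..s} (\<lambda>t. a g t - a h t)) \<le> integral {0..s} B"
    using B int by (intro integral_norm_bound_integral integrable_diff) auto
  then have "\<bar>integral {0..s} (a g) - integral {0..s} (a h)\<bar> \<le> I"
    using int B by (simp add: integral_diff integral_unique)
  then show ?thesis
    unfolding picard_step_def a_def by linarith
qed

definition picard_iterate :: "nat \<Rightarrow> real \<Rightarrow> real" where
  "picard_iterate n = (picard_step m f ^^ n) (\<lambda>_. 1)"

lemma picard_iterate_Suc: "picard_iterate (Suc n) = picard_step m f (picard_iterate n)"
  by (simp add: picard_iterate_def)

lemma picard_iterate_continuous: "continuous_on {0..T} (picard_iterate n)"
proof (induction n)
  case 0
  then show ?case by (simp add: picard_iterate_def)
next
  case (Suc n)
  then show ?case by (simp add: picard_iterate_Suc picard_step_continuous)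
qed

lemma picard_iterate_diff_le:
  assumes C: "\<And>t. t \<in> {0..T} \<Longrightarrow> \<bar>picard_iterate 1 t - picard_iterate 0 t\<bar> \<le> C"
    and s: "s \<in> {0..T}"
  shows "\<bar>picard_iterate (Suc n) s - picard_iterate n s\<bar> \<le> C * ((L * s) ^ n / fact n)"
  using s
proof (induction n arbitrary: s)
  case 0
  then show ?case using C[of s] by simp
next
  case (Suc n)
  have C0: "0 \<le> C" using C[OF Suc.prems] by linarith
  show ?case
    unfolding picard_iterate_Suc[of "Suc n"]  picard_iterate_Suc[of n]
  proof (rule picard_step_diff_le[where B = "\<lambda>t. L * (C * ((L * t) ^ n / fact n))"])
    have "((\<lambda>t. L * (C * ((L * t) ^ n / fact n))) has_integral
        C * ((L * s) ^ Suc n / fact (Suc n)) - C * ((L * 0) ^ Suc n / fact (Suc n))) {0..s}"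
      using Suc.prems
      by (intro fundamental_theorem_of_calculus)
         (auto intro!: derivative_eq_intros simp: divide_simps power_Suc[of L n]
           simp del: of_nat_Suc power_Suc
           simp flip: has_real_derivative_iff_has_vector_derivative)
    then show "((\<lambda>t. L * (C * ((L * t) ^ n / fact n))) has_integral
        C * ((L * s) ^ Suc n / fact (Suc n))) {0..s}" by simp
  next
    fix t t' :: real assume t: "0 \<le> t'" "t' \<le> t" "t \<le> s"
    have "\<bar>picard_iterate (Suc n) t' - picard_iterate n t'\<bar> \<le> C * ((L * t') ^ n / fact n)"
      using t Suc.prems by (intro Suc.IH) auto
    also have "\<dots> \<le> C * ((L * t) ^ n / fact n)"
      using t C0 lipschitz_nonneg by (intro mult_left_mono divide_right_mono power_mono) auto
    finally show "L * \<bar>picard_step m f (picard_iterate n) t' - picard_iterate n t'\<bar>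
        \<le> L * (C * ((L * t) ^ n / fact n))"
      using lipschitz_nonneg by (intro mult_left_mono) (simp_all add: picard_iterate_Suc)
  qed (use Suc.prems in \<open>auto intro!: picard_step_continuous picard_iterate_continuous\<close>)
qed

text \<open>
  The factorial decay of the increments makes the iterates converge uniformly on every bounded
  interval, so a single limit function solves the equation on the whole half-line.
\<close>

lemma radial_ivp_solution:
  obtains g where "\<And>T. continuous_on {0..T} g"
    and "\<And>s. 0 \<le> s \<Longrightarrow> g s = picard_step m f g s"
proof -
  define G where "G = picard_iterate"
  define g where "g s = 1 + (\<Sum>n. G (Suc n) s - G n s)" for s
  have lim: "uniform_limit {0..T} G g sequentially" for T
  proof (cases "0 \<le> T")
    case False
    then show ?thesis by (simp add: uniform_limit_iff)
  next
    case True
    have "continuous_on {0..T} (\<lambda>t. G 1 t - G 0 t)"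
      unfolding G_def by (intro continuous_intros picard_iterate_continuous)
    then have "bounded ((\<lambda>t. G 1 t - G 0 t) ` {0..T})"
      by (intro compact_imp_bounded compact_continuous_image) auto
    then obtain C where C: "\<And>t. t \<in> {0..T} \<Longrightarrow> \<bar>G 1 t - G 0 t\<bar> \<le> C"
      unfolding bounded_iff by (metis imageI real_norm_def)
    have C0: "0 \<le> C" using C[of 0] True by force
    have "uniform_limit {0..T} (\<lambda>n s. \<Sum>i<n. G (Suc i) s - G i s)
        (\<lambda>s. \<Sum>i. G (Suc i) s - G i s) sequentially"
    proof (rule Weierstrass_m_test)
      show "summable (\<lambda>n. C * ((L * T) ^ n / fact n))"
        using summable_exp[of "L * T"] by (intro summable_mult) (simp add: field_simps)
      fix n s assume s: "s \<in> {0..T}"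
      have "\<bar>G (Suc n) s - G n s\<bar> \<le> C * ((L * s) ^ n / fact n)"
        using picard_iterate_diff_le[of T C s n] C s by (simp add: G_def)
      also have "\<dots> \<le> C * ((L * T) ^ n / fact n)"
        using s C0 lipschitz_nonneg
        by (intro mult_left_mono divide_right_mono power_mono) auto
      finally show "norm (G (Suc n) s - G n s) \<le> C * ((L * T) ^ n / fact n)" by simp
    qed
    then have "uniform_limit {0..T} (\<lambda>n s. 1 + (\<Sum>i<n. G (Suc i) s - G i s)) g sequentially"
      unfolding g_def by (intro uniform_limit_intros)
    moreover have "(\<lambda>n s. 1 + (\<Sum>i<n. G (Suc i) s - G i s)) = G"
      by (subst sum_lessThan_telescope) (auto simp: G_def picard_iterate_def)
    ultimately show ?thesis by simp
  qed
  have cont: "continuous_on {0..T} g" for T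
    by (rule uniform_limit_theorem[OF _ lim]) (auto simp: G_def picard_iterate_continuous)
  moreover have "g s = picard_step m f g s" if s: "0 \<le> s" for s
  proof (rule LIMSEQ_unique)
    have "(\<lambda>n. G n s) \<longlonglongrightarrow> g s"
      using tendsto_uniform_limitI[OF lim[of s]] s by auto
    then show "(\<lambda>n. G (Suc n) s) \<longlonglongrightarrow> g s" by (rule LIMSEQ_Suc)
    show "(\<lambda>n. G (Suc n) s) \<longlonglongrightarrow> picard_step m f g s"
    proof (rule tendstoI)
      fix e :: real assume e: "0 < e"
      define d where "d = e / (L * s + 1)"
      have Ls: "0 \<le> L * s" using lipschitz_nonneg s by simp
      have d: "0 < d" "L * s * d < e" using e Ls by (auto simp: d_def field_simps)
      have "\<forall>\<^sub>F n in sequentially. \<forall>t\<in>{0..s}. dist (G n t) (g t) < d"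
        using lim[of s] d by (auto simp: uniform_limit_iff)
      then show "\<forall>\<^sub>F n in sequentially. dist (G (Suc n) s) (picard_step m f g s) < e"
      proof eventually_elim
        case (elim n)
        have "\<bar>picard_step m f (G n) s - picard_step m f g s\<bar> \<le> s * (L * d)"
        proof (rule picard_step_diff_le[where B = "\<lambda>_. L * d"])
          show "((\<lambda>_. L * d) has_integral s * (L * d)) {0..s}"
            using has_integral_const_real[of "L * d" 0 s] s by simp
        next
          fix t t' :: real assume "0 \<le> t'" "t' \<le> t" "t \<le> s"
          then show "L * \<bar>G n t' - g t'\<bar> \<le> L * d"
            using bspec[OF elim, of t'] lipschitz_nonneg
            by (intro mult_left_mono) (auto simp: dist_real_def)
        qed (use s cont in \<open>auto simp: G_def picard_iterate_continuous\<close>)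
        then show ?case
          using d by (simp add: dist_real_def G_def picard_iterate_Suc mult_ac)
      qed
    qed
  qed
  ultimately show ?thesis by (rule that)
qed

end

section \<open>Shooting for the Robin condition\<close>

text \<open>
  The power, cut off outside \<open>{0..1}\<close>. It is globally Lipschitz and bounded, so the initial value
  problem is solvable for all \<open>s\<close>, and it agrees with the power along a profile that starts at 1 and
  decreases, as long as the profile is positive.
\<close>

definition cutoff_power :: "real \<Rightarrow> real \<Rightarrow> real" where
  "cutoff_power p y = max 0 (min 1 y) powr p"

lemma powr_unit_interval_lipschitz:
  fixes p x y :: real
  assumes p: "1 \<le> p" and "0 \<le> x" "x \<le> y" "y \<le> 1"
  shows "y powr p - x powr p \<le> p * (y - x)"
proof (cases "x < y")
  case True
  have der: "((\<lambda>z. z powr p) has_real_derivative p * z powr (p - 1)) (at z)" if "x < z" for z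
    using that assms by (intro has_real_derivative_powr) auto
  have "\<exists>l z. x < z \<and> z < y \<and> ((\<lambda>z. z powr p) has_real_derivative l) (at z)
      \<and> y powr p - x powr p = (y - x) * l"
  proof (rule MVT[OF True])
    show "continuous_on {x..y} (\<lambda>z. z powr p)"
      using assms by (intro continuous_on_powr' continuous_intros) auto
    show "(\<lambda>z. z powr p) differentiable (at z)" if "x < z" "z < y" for z
      using der[OF that(1)] real_differentiable_def by blast
  qed
  then obtain z where z: "x < z" "z < y" "y powr p - x powr p = (y - x) * (p * z powr (p - 1))"
    using der DERIV_unique by blast
  have "z powr (p - 1) \<le> 1" using z assms by (intro powr_le1) auto
  then have "(y - x) * (p * z powr (p - 1)) \<le> (y - x) * p"
    using True p by (intro mult_left_mono mult_left_le) auto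
  then show ?thesis using z by (simp add: mult.commute)
qed (use assms in auto)

lemma cutoff_power_lipschitz:
  assumes p: "1 \<le> p"
  shows "\<bar>cutoff_power p x - cutoff_power p y\<bar> \<le> p * \<bar>x - y\<bar>"
proof -
  have *: "\<bar>cutoff_power p x - cutoff_power p y\<bar> \<le> p * \<bar>x - y\<bar>" if "x \<le> y" for x y
  proof -
    define X Y :: real where "X = max 0 (min 1 x)" and "Y = max 0 (min 1 y)"
    have XY: "0 \<le> X" "X \<le> Y" "Y \<le> 1" "Y - X \<le> y - x" using that by (auto simp: X_def Y_def)
    have "X powr p \<le> Y powr p" using XY p by (intro powr_mono2) auto
    moreover have "Y powr p - X powr p \<le> p * (Y - X)"
      using XY p by (intro powr_unit_interval_lipschitz)
    moreover have "p * (Y - X) \<le> p * (y - x)" using XY p by (intro mult_left_mono) auto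
    ultimately show ?thesis using that by (simp add: cutoff_power_def X_def Y_def)
  qed
  show ?thesis using *[of x y] *[of y x] by (cases "x \<le> y") (auto simp: abs_minus_commute)
qed

lemma cutoff_power_mono: "0 \<le> p \<Longrightarrow> x \<le> y \<Longrightarrow> cutoff_power p x \<le> cutoff_power p y"
  unfolding cutoff_power_def by (intro powr_mono2) auto

lemma cutoff_power_bounds: "0 \<le> p \<Longrightarrow> 0 \<le> cutoff_power p x \<and> cutoff_power p x \<le> 1"
  unfolding cutoff_power_def by (auto intro!: powr_le1)

lemma mean_value_within:
  fixes f f' :: "real \<Rightarrow> real"
  assumes "a \<le> c" "\<And>s. s \<in> {a..c} \<Longrightarrow> (f has_real_derivative f' s) (at s within {a..c})"
  obtains s where "s \<in> {a..c}" "f c - f a = f' s * (c - a)"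
  using mvt_very_simple[OF assms(1), of f "\<lambda>s h. f' s * h"] assms(2)
  by (auto simp: has_field_derivative_def)

text \<open>
  The weighted function has derivative \<open>s powr (b / 2 - 1) * (b * g s - s * q s) / 2\<close>. For positive
  \<open>g\<close> this is a comparison of logarithmic derivatives: \<open>g\<close> decays no faster than \<open>s powr - (b / 2)\<close>.
\<close>

lemma power_weighted_mono:
  fixes g q :: "real \<Rightarrow> real"
  assumes ac: "0 < a" "a \<le> c"
    and der: "\<And>s. s \<in> {a..c} \<Longrightarrow> (g has_real_derivative - q s / 2) (at s within {a..c})"
    and le: "\<And>s. s \<in> {a..c} \<Longrightarrow> s * q s \<le> b * g s"
  shows "a powr (b / 2) * g a \<le> c powr (b / 2) * g c"
proof -
  have "((\<lambda>s. s powr (b / 2) * g s) has_real_derivative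
      s powr (b / 2 - 1) * (b * g s - s * q s) / 2) (at s within {a..c})" if "s \<in> {a..c}" for s
  proof -
    have s: "0 < s" using that ac by auto
    have "((\<lambda>s. s powr (b / 2) * g s) has_real_derivative
      s powr (b / 2) * (- q s / 2) + (b / 2 * s powr (b / 2 - 1)) * g s) (at s within {a..c})"
      using s by (intro DERIV_mult' der that has_field_derivative_at_within[OF has_real_derivative_powr])
    moreover have "s powr (b / 2) = s powr (b / 2 - 1) * s"
      using s by (simp add: powr_diff)
    ultimately show ?thesis by (simp add: algebra_simps diff_divide_distrib)
  qed
  then obtain x where x: "x \<in> {a..c}" and eq: "c powr (b / 2) * g c - a powr (b / 2) * g a
      = (x powr (b / 2 - 1) * (b * g x - x * q x) / 2) * (c - a)"
    by (rule mean_value_within[OF ac(2)])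
  have "0 \<le> (x powr (b / 2 - 1) * (b * g x - x * q x) / 2) * (c - a)"
    using le[OF x] ac by (intro mult_nonneg_nonneg divide_nonneg_nonneg) auto
  then show ?thesis unfolding eq[symmetric] by simp
qed

lemma first_nonneg_point:
  fixes H :: "real \<Rightarrow> real"
  assumes T: "0 \<le> T" and H: "continuous_on {0..T} H" "H 0 < 0" "0 \<le> H T"
  obtains S where "0 < S" "S \<le> T" "H S = 0" "\<And>s. 0 \<le> s \<Longrightarrow> s < S \<Longrightarrow> H s < 0"
proof -
  define Z where "Z = {s \<in> {0..T}. H s = 0}"
  have "closed Z" unfolding Z_def
    by (rule continuous_closed_preimage_constant[OF H(1)]) simp
  moreover have "bounded Z" by (rule bounded_subset[of "{0..T}"]) (auto simp: Z_def)
  ultimately have "compact Z" by (simp add: compact_eq_bounded_closed)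
  moreover have "Z \<noteq> {}" using IVT'[of H 0 0 T] H T by (auto simp: Z_def)
  ultimately obtain S where S: "S \<in> Z" "\<And>s. s \<in> Z \<Longrightarrow> S \<le> s"
    by (meson compact_attains_inf)
  have "H s < 0" if s: "0 \<le> s" "s < S" for s
  proof (rule ccontr)
    assume "\<not> H s < 0"
    then have "\<exists>x\<ge>0. x \<le> s \<and> H x = 0"
      using s S H by (intro IVT') (auto simp: Z_def intro: continuous_on_subset[OF H(1)])
    then obtain x where "x \<in> Z" "x \<le> s" using s S by (auto simp: Z_def)
    then show False using S(2)[of x] s by simp
  qed
  moreover have "S \<noteq> 0" using S(1) H(2) by (auto simp: Z_def)
  ultimately show ?thesis using S(1) that[of S] by (auto simp: Z_def)
qed

text \<open>
  The quotient \<open>s * q s / g s\<close> starts at 0, and the claim is that it reaches \<open>b\<close> while \<open>g\<close> is still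
  positive. If it stayed below \<open>b\<close>, then \<open>g s \<ge> s powr - (b / 2) / 2\<close> for \<open>s \<ge> 1\<close> by
  \<open>power_weighted_mono\<close>. Since \<open>g\<close> decreases, \<open>q s\<close> is at least \<open>g s powr p / (m + 1)\<close>, so the quotient would be
  at least a constant times \<open>s powr (1 - b * (p - 1) / 2)\<close>. The exponent is positive exactly when
  \<open>b < 2 / (p - 1)\<close>, and then this is unbounded.
\<close>

lemma shooting:
  fixes g :: "real \<Rightarrow> real" and p b :: real and m :: nat
  defines "q \<equiv> radial_average m (\<lambda>t. cutoff_power p (g t))"
  assumes p: "1 < p" and b: "0 < b" "b < 2 / (p - 1)"
    and cont: "\<And>T. continuous_on {0..T} g"
    and eq: "\<And>s. 0 \<le> s \<Longrightarrow> g s = picard_step m (cutoff_power p) g s"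
  obtains S where "0 < S" "S * q S = b * g S" "\<And>s. s \<in> {0..S} \<Longrightarrow> 0 < g s \<and> g s \<le> 1"
    "\<And>s. s \<in> {0..S} \<Longrightarrow> (g has_real_derivative - q s / 2) (at s within {0..S})"
proof -
  have contf: "continuous_on {0..T} (\<lambda>t. cutoff_power p (g t))" for T
    using p cont by (intro continuous_on_nonlinearity[OF cutoff_power_lipschitz]) auto
  have contq: "continuous_on {0..T} q" for T
    unfolding q_def by (intro radial_average_continuous contf)
  have der: "(g has_real_derivative - q s / 2) (at s within {a..c})"
    if "0 \<le> a" "s \<in> {a..c}" for s a c
  proof -
    have "((\<lambda>s. 1 - integral {0..s} q / 2) has_real_derivative 0 - q s / 2) (at s within {0..c})"
      using that by (intro DERIV_diff DERIV_const DERIV_cdivide integral_has_real_derivative contq) auto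
    then have "(g has_real_derivative - q s / 2) (at s within {0..c})"
      by (rule has_field_derivative_transform_within[OF _ zero_less_one, THEN DERIV_cong])
         (use that eq in \<open>auto simp: picard_step_def q_def\<close>)
    then show ?thesis by (rule has_field_derivative_subset) (use that in auto)
  qed
  have q_bounds: "0 \<le> q s" "q s \<le> 1" if "0 \<le> s" for s
  proof -
    show "0 \<le> q s" unfolding q_def
      using radial_average_ge[OF contf that, of 0 m] cutoff_power_bounds[of p] p by auto
    show "q s \<le> 1" unfolding q_def
      using radial_average_abs_le[OF contf that, of 1 m] cutoff_power_bounds[of p] p
      by (auto simp: abs_le_iff)
  qed
  have g0: "g 0 = 1" using eq[of 0] by (simp add: picard_step_def)
  have g_anti: "g c \<le> g a" if ac: "0 \<le> a" "a \<le> c" for a c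
  proof -
    obtain x where x: "x \<in> {a..c}" "g c - g a = (- q x / 2) * (c - a)"
      using mean_value_within[OF ac(2) der[OF ac(1)]] .
    have "0 \<le> q x * (c - a)" using x(1) ac q_bounds[of x] by auto
    then show ?thesis using x(2) by simp
  qed
  have g_le1: "g s \<le> 1" if "0 \<le> s" for s using g_anti[of 0 s] that g0 by simp
  have g1: "1 / 2 \<le> g 1"
  proof -
    obtain x where x: "x \<in> {0..1}" "g 1 - g 0 = (- q x / 2) * (1 - 0)"
      using mean_value_within[OF zero_le_one der[OF order_refl]] .
    then show ?thesis using q_bounds[of x] g0 by simp
  qed
  have q_ge: "g s powr p / (real m + 1) \<le> q s" if "0 \<le> s" "0 < g s" for s
  proof -
    have "cutoff_power p (g s) / (real m + 1) \<le> q s"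
      unfolding q_def using p that g_anti
      by (intro radial_average_ge contf cutoff_power_mono) auto
    then show ?thesis using that g_le1[of s] by (simp add: cutoff_power_def)
  qed
  define H where "H s = s * q s - b * g s" for s
  have "\<exists>T\<ge>0. 0 \<le> H T"
  proof (rule ccontr)
    assume neg: "\<not> (\<exists>T\<ge>0. 0 \<le> H T)"
    then have lt: "s * q s < b * g s" if "0 \<le> s" for s using that by (force simp: H_def)
    have pos: "0 < g s" if "0 \<le> s" for s
      using lt[OF that] q_bounds(1)[OF that] that b(1) 
      by (metis mult_nonneg_nonneg order_le_less_trans zero_less_mult_pos)
    define e where "e = 1 - b * (p - 1) / 2"
    have e: "0 < e" using b p by (simp add: e_def field_simps)
    define K where "K = b * (real m + 1) * 2 powr (p - 1) + 1"
    have K: "1 \<le> K" using b by (simp add: K_def)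
    \<comment> \<open>This \<open>s\<close> has \<open>s powr e = K\<close>, more than the bound on \<open>s powr e\<close> that the assumption forces.\<close>
    define s where "s = K powr (1 / e)"
    have s: "1 \<le> s" using K e by (simp add: s_def ge_one_powr_ge_zero)
    have "1 powr (b / 2) * g 1 \<le> s powr (b / 2) * g s"
      using s lt by (intro power_weighted_mono[where q = q] der) (auto intro: less_imp_le)
    then have low: "s powr (- (b / 2)) / 2 \<le> g s"
      using g1 s by (simp add: powr_minus field_simps)
    have "s * (g s powr p / (real m + 1)) \<le> s * q s"
      using q_ge[of s] pos[of s] s by (intro mult_left_mono) auto
    also have "\<dots> < b * g s" using lt s by simp
    finally have "s * g s powr p < b * (real m + 1) * g s" by (simp add: field_simps)
    moreover have "g s powr p = g s powr (p - 1) * g s"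
      using pos[of s] s by (simp add: powr_diff)
    ultimately have up: "s * g s powr (p - 1) < b * (real m + 1)"
      using pos[of s] s by (simp add: mult.assoc[symmetric])
    have "s powr e = s * s powr (- (b / 2) * (p - 1))"
    proof -
      have "e = 1 + - (b / 2) * (p - 1)" by (simp add: e_def field_simps)
      then show ?thesis using s by (simp only: powr_add) simp
    qed
    also have "\<dots> = 2 powr (p - 1) * (s * (s powr (- (b / 2)) / 2) powr (p - 1))"
      using s by (simp add: powr_divide powr_powr)
    also have "\<dots> \<le> 2 powr (p - 1) * (s * g s powr (p - 1))"
      using s low p by (intro mult_left_mono powr_mono2) auto
    also have "\<dots> < 2 powr (p - 1) * (b * (real m + 1))"
      using up by (intro mult_strict_left_mono) auto
    also have "\<dots> < K" by (simp add: K_def mult_ac)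
    finally show False using e K by (simp add: s_def powr_powr)
  qed
  then obtain T where T: "0 \<le> T" "0 \<le> H T" by blast
  have "continuous_on {0..T} H"
    unfolding H_def[abs_def] by (intro continuous_intros contq cont)
  then obtain S where S: "0 < S" "H S = 0" "\<And>s. 0 \<le> s \<Longrightarrow> s < S \<Longrightarrow> H s < 0"
    using first_nonneg_point[of T H] T b g0 by (auto simp: H_def)
  have pos: "0 < g s" if "0 \<le> s" "s < S" for s
  proof -
    have "s * q s < b * g s" using S(3)[OF that] by (simp add: H_def)
    moreover have "0 \<le> s * q s" using q_bounds that by simp
    ultimately show ?thesis using b(1) by (metis order_le_less_trans zero_less_mult_pos)
  qed
  \<comment> \<open>At \<open>S\<close> itself \<open>b * g S = S * q S\<close> only gives \<open>g S \<ge> 0\<close>; the comparison from \<open>S / 2\<close> excludes a zero.\<close>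
  have "(S / 2) powr (b / 2) * g (S / 2) \<le> S powr (b / 2) * g S"
  proof (rule power_weighted_mono[where q = q])
    fix s assume "s \<in> {S / 2..S}"
    then show "s * q s \<le> b * g s" using S(1,2) S(3)[of s] by (cases "s = S") (auto simp: H_def)
  qed (use S(1) der in auto)
  moreover have "0 < (S / 2) powr (b / 2) * g (S / 2)" using pos[of "S / 2"] S(1) by simp
  ultimately have "0 < g S" using S(1) by (metis order_less_le_trans powr_gt_zero zero_less_mult_pos less_numeral_extra(3))
  show ?thesis
  proof (rule that[of S])
    show "0 < g s \<and> g s \<le> 1" if "s \<in> {0..S}" for s
      using pos[of s] \<open>0 < g S\<close> g_le1[of s] that by (cases "s = S") auto
  qed (use S der in \<open>auto simp: H_def\<close>)
qed

text \<open>
  With \<open>u x = g (norm x ^ 2)\<close> the last equation is \<open>-\<Delta>u = u\<^sup>p\<close>, since the gradient of \<open>u\<close> at \<open>x\<close> is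
  \<open>- q (norm x ^ 2) *\<^sub>R x\<close>; the condition at \<open>S\<close> is the Robin condition on the sphere of radius
  \<open>sqrt S\<close>, with \<open>b\<close> the product of the Robin coefficient and the radius.
\<close>

lemma radial_profile:
  fixes p b :: real and N :: nat
  assumes N: "1 \<le> N" and p: "1 < p" and b: "0 < b" "b < 2 / (p - 1)"
  obtains S :: real and q g q' :: "real \<Rightarrow> real" where
    "0 < S" "S * q S = b * g S" "\<And>s. s \<in> {0..S} \<Longrightarrow> 0 < g s"
    "\<And>s. s \<in> {0..S} \<Longrightarrow> (g has_real_derivative - q s / 2) (at s within {0..S})"
    "\<And>s. s \<in> {0..S} \<Longrightarrow> (q has_real_derivative q' s) (at s within {0..S})"
    "continuous_on {0..S} q'"
    "\<And>s. s \<in> {0..S} \<Longrightarrow> N * q s + 2 * s * q' s = g s powr p"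
proof -
  define m where "m = N - 1"
  obtain g where "\<And>T. continuous_on {0..T} g"
    and ivp: "\<And>s. 0 \<le> s \<Longrightarrow> g s = picard_step m (cutoff_power p) g s"
    using radial_ivp_solution[OF cutoff_power_lipschitz[of p], of m] p by auto
  define q where "q = radial_average m (\<lambda>t. cutoff_power p (g t))"
  obtain S where S: "0 < S" "S * q S = b * g S" and g: "\<And>s. s \<in> {0..S} \<Longrightarrow> 0 < g s \<and> g s \<le> 1"
    and der: "\<And>s. s \<in> {0..S} \<Longrightarrow> (g has_real_derivative - q s / 2) (at s within {0..S})"
    using shooting[OF p b \<open>\<And>T. continuous_on {0..T} g\<close>, where m = m, folded q_def] ivp by blast
  define h where "h t = cutoff_power p (g t)" for t
  define h' where "h' t = p * g t powr (p - 1) * (- q t / 2)" for t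
  have h: "h s = g s powr p" if "s \<in> {0..S}" for s
    using g[OF that] by (simp add: h_def cutoff_power_def)
  have contg: "continuous_on {0..S} g" by fact
  have contq: "continuous_on {0..S} q"
    unfolding q_def using p contg
    by (intro radial_average_continuous continuous_on_nonlinearity[OF cutoff_power_lipschitz]) auto
  have conth': "continuous_on {0..S} h'"
    unfolding h'_def[abs_def] using g by (intro continuous_intros contg contq) force+
  have derh: "(h has_real_derivative h' s) (at s within {0..S})" if s: "s \<in> {0..S}" for s
  proof -
    have "((\<lambda>s. g s powr p) has_real_derivative h' s) (at s within {0..S})"
      unfolding h'_def using g[OF s]
      using DERIV_chain2[OF has_real_derivative_powr[of "g s" p] der[OF s]] by simp
    then show ?thesis
      by (rule has_field_derivative_transform_within[OF _ zero_less_one]) (use h s in auto)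
  qed
  have q_h: "q = radial_average m h" by (simp add: q_def h_def[abs_def])
  note sm = radial_average_smooth[OF S(1) derh conth', where m = m, folded q_h]
  show ?thesis
    by (rule that[OF S _ der sm(1,2)]) (use g h sm(3) N in \<open>auto simp: m_def of_nat_diff\<close>)
qed

section \<open>One-sided derivatives on convex sets\<close>

text \<open>
  At a boundary point \<open>x\<close> of a ball the coordinate directions may leave the closed ball, so
  uniqueness cannot be tested on them. Two derivatives agree on \<open>y - x\<close> for every \<open>y\<close> in the set, by
  restriction to the segment from \<open>x\<close> to \<open>y\<close>, and the differences of such vectors, taken at an
  interior point, cover all directions.
\<close>

lemma has_derivative_unique_on_convex:
  fixes f :: "'a::euclidean_space \<Rightarrow> real"
  assumes S: "convex S" "interior S \<noteq> {}" "x \<in> S"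
    and D: "(f has_derivative D) (at x within S)" and E: "(f has_derivative E) (at x within S)"
  shows "D = E"
proof -
  interpret D: bounded_linear D using D by (rule has_derivative_bounded_linear)
  interpret E: bounded_linear E using E by (rule has_derivative_bounded_linear)
  have eq: "D (y - x) = E (y - x)" if y: "y \<in> S" for y
  proof -
    define l where "l t = x + t *\<^sub>R (y - x)" for t :: real
    have l: "l ` {0..1} \<subseteq> S"
    proof
      fix z assume "z \<in> l ` {0..1}"
      then obtain t where t: "0 \<le> t" "t \<le> 1" "z = (1 - t) *\<^sub>R x + t *\<^sub>R y"
        by (auto simp: l_def algebra_simps)
      then show "z \<in> S" using convexD[OF S(1,3) y, of "1 - t" t] by simp
    qed
    have dl: "(l has_derivative (\<lambda>t. t *\<^sub>R (y - x))) (at 0 within {0..1})"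
      unfolding l_def by (auto intro!: derivative_eq_intros)
    have vec: "((f \<circ> l) has_vector_derivative F (y - x)) (at 0 within {0..1})"
      if F: "(f has_derivative F) (at x within S)" for F
    proof -
      interpret F: bounded_linear F using F by (rule has_derivative_bounded_linear)
      have "(f has_derivative F) (at (l 0) within l ` {0..1})"
        using F l by (simp add: l_def has_derivative_subset)
      from diff_chain_within[OF dl this] show ?thesis
        by (simp add: has_vector_derivative_def o_def F.scaleR)
    qed
    show ?thesis
      using vector_derivative_unique_within[OF _ vec[OF D] vec[OF E]]
      by (simp add: trivial_limit_within islimpt_Icc)
  qed
  obtain z e where z: "0 < e" "ball z e \<subseteq> S" using S(2) by (auto simp: mem_interior)
  show "D = E"
  proof
    fix v :: 'a
    define n where "n = norm v + 1"
    have nv: "0 < n" by (simp add: n_def add_nonneg_pos)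
    \<comment> \<open>Small enough for \<open>z + t *\<^sub>R v\<close> to stay in the ball around the interior point \<open>z\<close>.\<close>
    define t where "t = e / (2 * n)"
    have t: "0 < t" using z nv by (simp add: t_def)
    have "t * norm v < e"
    proof -
      have "t * norm v \<le> t * n" using t by (simp add: n_def)
      also have "\<dots> = e / 2" using nv by (simp add: t_def field_simps)
      finally show ?thesis using z by simp
    qed
    then have "z + t *\<^sub>R v \<in> S" "z \<in> S" using z t by (auto simp: dist_norm)
    then have "D (z + t *\<^sub>R v - x) - D (z - x) = E (z + t *\<^sub>R v - x) - E (z - x)"
      by (simp add: eq)
    then have "t * D v = t * E v"
      by (simp add: D.add D.diff E.add E.diff D.scaleR E.scaleR)
    then show "D v = E v" using t by simp
  qed
qed

lemma dir_deriv_eq: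
  assumes "convex S" "interior S \<noteq> {}" "x \<in> S" "(f has_derivative D) (at x within S)"
  shows "dir_deriv S f v x = D v"
proof -
  have "(f has_derivative frechet_derivative f (at x within S)) (at x within S)"
    using assms(4) frechet_derivative_works differentiable_def by blast
  then show ?thesis
    unfolding dir_deriv_def using has_derivative_unique_on_convex[OF assms(1-3) _ assms(4)] by metis
qed

lemma dir_deriv_cong:
  assumes "\<And>y. y \<in> S \<Longrightarrow> f y = g y" "x \<in> S"
  shows "dir_deriv S f v x = dir_deriv S g v x"
proof -
  have "(f has_derivative D) (at x within S) \<longleftrightarrow> (g has_derivative D) (at x within S)" for D
    using assms by (metis has_derivative_transform)
  then show ?thesis by (simp add: dir_deriv_def frechet_derivative_def)
qed

lemma C1_onI:
  assumes S: "convex S" "interior S \<noteq> {}"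
    and der: "\<And>x. x \<in> S \<Longrightarrow> (f has_derivative D x) (at x within S)"
    and cont: "\<And>b. b \<in> Basis \<Longrightarrow> continuous_on S (\<lambda>x. D x b)"
  shows "C1_on S f"
proof -
  have "dir_deriv S f v x = D x v" if "x \<in> S" for x v
    using dir_deriv_eq[OF S that der[OF that]] .
  then have "continuous_on S (dir_deriv S f b)" if "b \<in> Basis" for b
    using cont[OF that] by (simp cong: continuous_on_cong)
  then show ?thesis
    using der by (auto simp: C1_on_def differentiable_on_def differentiable_def)
qed

lemma C1_on_cong:
  assumes "\<And>x. x \<in> S \<Longrightarrow> f x = g x"
  shows "C1_on S f \<longleftrightarrow> C1_on S g"
proof -
  have "f differentiable_on S \<longleftrightarrow> g differentiable_on S"
    using assms unfolding differentiable_on_def differentiable_def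
    by (metis has_derivative_transform)
  moreover have "continuous_on S (dir_deriv S f b) \<longleftrightarrow> continuous_on S (dir_deriv S g b)" for b
    using dir_deriv_cong[of S f g] assms by (intro continuous_on_cong) auto
  ultimately show ?thesis by (simp add: C1_on_def)
qed

section \<open>From the profile to the ball\<close>

text \<open>
  The equation \<open>-\<Delta>u = u\<^sup>p\<close> is invariant under \<open>u \<mapsto> \<lambda> powr (2 / (p - 1)) * u (\<lambda> x)\<close>. Here
  \<open>k = \<lambda>\<^sup>2\<close> is chosen to carry the sphere of radius \<open>R\<close> to \<open>s = S\<close>, and then \<open>\<beta> * R\<close> is the scale-invariant
  form of the Robin coefficient. Working with functions of \<open>(norm (x - c))\<^sup>2\<close> makes all derivatives
  continuous at the centre without a separate argument, and one-sided derivatives of the profile on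
  \<open>{0..S}\<close> are enough because this map sends the closed ball into that interval.
\<close>

lemma radial_solution_of_profile:
  fixes c :: "'a::euclidean_space" and g q q' :: "real \<Rightarrow> real" and N :: nat
  assumes N: "N = DIM('a)" and p: "1 < p" and R: "0 < R"
    and S: "0 < S" "S * q S = \<beta> * R * g S" and pos: "\<And>s. s \<in> {0..S} \<Longrightarrow> 0 < g s"
    and derg: "\<And>s. s \<in> {0..S} \<Longrightarrow> (g has_real_derivative - q s / 2) (at s within {0..S})"
    and derq: "\<And>s. s \<in> {0..S} \<Longrightarrow> (q has_real_derivative q' s) (at s within {0..S})"
    and contq': "continuous_on {0..S} q'"
    and ode: "\<And>s. s \<in> {0..S} \<Longrightarrow> N * q s + 2 * s * q' s = g s powr p"
  defines "k \<equiv> S / R\<^sup>2"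
  shows "positive_robin_solution (ball c R) (outward_normal_ball c R) p \<beta>
    (\<lambda>x. k powr (1 / (p - 1)) * g (k * (norm (x - c))\<^sup>2))"
proof -
  define A where "A = k powr (1 / (p - 1))"
  define r where "r x = k * (norm (x - c))\<^sup>2" for x
  define u where "u x = A * g (r x)" for x
  \<comment> \<open>The derivative of \<open>u\<close> at \<open>x\<close> in direction \<open>b\<close>, linear in \<open>b\<close>.\<close>
  define d where "d b x = - A * k * (q (r x) * ((x - c) \<bullet> b))" for b x
  have k: "0 < k" using S R by (simp add: k_def)
  have A: "0 < A" using k by (simp add: A_def)
  \<comment> \<open>The amplitude \<open>A\<close> is determined by this equation: \<open>-\<Delta>u\<close> gains the factor \<open>A * k\<close>, \<open>u\<^sup>p\<close> the factor \<open>A powr p\<close>.\<close>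
  have Ak: "A * k = A powr p"
  proof -
    have "A powr (p - 1) = k" using p k by (simp add: A_def powr_powr)
    then show ?thesis using A by (simp add: powr_diff field_simps)
  qed
  have r_mem: "r x \<in> {0..S}" if "x \<in> cball c R" for x
  proof -
    have "(norm (x - c))\<^sup>2 \<le> R\<^sup>2"
      using that by (intro power_mono) (auto simp: dist_norm norm_minus_commute)
    then have "r x \<le> k * R\<^sup>2" using k unfolding r_def by (intro mult_left_mono) auto
    moreover have "0 \<le> r x" using k by (simp add: r_def)
    ultimately show ?thesis using R by (simp add: k_def)
  qed
  have der_r: "(r has_derivative (\<lambda>h. 2 * k * ((x - c) \<bullet> h))) (at x within X)" for x X
    unfolding r_def power2_norm_eq_inner
    by (auto intro!: derivative_eq_intros simp: inner_commute)
  have contr: "continuous_on X r" for X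
    unfolding r_def by (intro continuous_intros)
  have chain: "((\<lambda>x. f (r x)) has_derivative (\<lambda>h. f' (r x) * (2 * k * ((x - c) \<bullet> h))))
      (at x within X)"
    if der: "\<And>s. s \<in> {0..S} \<Longrightarrow> (f has_real_derivative f' s) (at s within {0..S})"
      and X: "X \<subseteq> cball c R" "x \<in> X" for f f' :: "real \<Rightarrow> real" and x X
  proof -
    have "r ` X \<subseteq> {0..S}" using r_mem X by blast
    moreover have "r x \<in> {0..S}" using r_mem X by blast
    ultimately have "(f has_real_derivative f' (r x)) (at (r x) within r ` X)"
      using has_field_derivative_subset[OF der] by blast
    then have "(f has_derivative (\<lambda>h. f' (r x) * h)) (at (r x) within r ` X)"
      by (simp add: has_field_derivative_def)
    from diff_chain_within[OF der_r this] show ?thesis by (simp add: o_def)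
  qed
  have contq: "continuous_on {0..S} q"
    using derq by (meson DERIV_continuous continuous_on_eq_continuous_within)
  have contcomp: "continuous_on X (\<lambda>x. f (r x))"
    if "continuous_on {0..S} f" "X \<subseteq> cball c R" for f :: "real \<Rightarrow> real" and X
    using r_mem that by (intro continuous_on_compose2[OF that(1) contr]) blast
  have der_u: "(u has_derivative (\<lambda>h. d h x)) (at x within X)" if "X \<subseteq> cball c R" "x \<in> X" for x X
    unfolding u_def
    by (rule has_derivative_eq_rhs[OF has_derivative_mult_right[OF chain[OF derg that]]])
       (auto simp: d_def)
  have der_d: "(d b has_derivative (\<lambda>h. - A * k * (q (r x) * (h \<bullet> b)
        + q' (r x) * (2 * k * ((x - c) \<bullet> h)) * ((x - c) \<bullet> b)))) (at x within X)"
    if "X \<subseteq> cball c R" "x \<in> X" for b x X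
    unfolding d_def
    by (intro has_derivative_mult_right has_derivative_mult chain[OF derq that])
       (auto intro!: derivative_eq_intros)
  have cont_d: "continuous_on X (d b)" if "X \<subseteq> cball c R" for b X
    unfolding d_def by (intro continuous_intros contcomp contq that)
  have ball: "convex (ball c R)" "interior (ball c R) \<noteq> {}" "ball c R \<subseteq> cball c R"
    using R by (auto simp: interior_open)
  have cball: "convex (cball c R)" "interior (cball c R) \<noteq> {}"
    using R by auto
  have du: "dir_deriv (ball c R) u b x = d b x" if "x \<in> ball c R" for b x
    using dir_deriv_eq[OF ball(1,2) that der_u[OF ball(3) that]] .
  have "C1_on (ball c R) u"
    by (rule C1_onI[OF ball(1,2) der_u[OF ball(3)] cont_d[OF ball(3)]])
  moreover have "C1_on (ball c R) (d b)" for b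
    by (rule C1_onI[OF ball(1,2) der_d[OF ball(3)]])
       (auto intro!: continuous_intros contcomp contq contq')
  then have "C1_on (ball c R) (dir_deriv (ball c R) u b)" for b
    using C1_on_cong[of "ball c R" "dir_deriv (ball c R) u b" "d b", OF du] by blast
  ultimately have C2: "C2_on (ball c R) u"
    by (simp add: C2_on_def)
  have C1: "C1_on (closure (ball c R)) u"
    unfolding closure_ball[OF R]
    by (rule C1_onI[OF cball der_u[OF order_refl] cont_d[OF order_refl]])
  have lap: "- laplacian (ball c R) u x = u x powr p" if x: "x \<in> ball c R" for x
  proof -
    define y where "y = x - c"
    have "dir_deriv (ball c R) (dir_deriv (ball c R) u b) b x
        = - A * k * (q (r x) * (b \<bullet> b) + q' (r x) * (2 * k * (y \<bullet> b)) * (y \<bullet> b))" for b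
      using dir_deriv_cong[of "ball c R" "dir_deriv (ball c R) u b" "d b" x b, OF du x]
        dir_deriv_eq[OF ball(1,2) x der_d[OF ball(3) x]] by (simp add: y_def)
    then have "laplacian (ball c R) u x
        = (\<Sum>b\<in>Basis. - A * k * (q (r x) * (b \<bullet> b) + q' (r x) * (2 * k * (y \<bullet> b)) * (y \<bullet> b)))"
      by (simp add: laplacian_def)
    also have "\<dots> = - A * k * (\<Sum>b\<in>Basis. q (r x) + 2 * k * q' (r x) * (y \<bullet> b)\<^sup>2)"
      unfolding sum_distrib_left by (intro sum.cong) (auto simp: power2_eq_square)
    also have "(\<Sum>b\<in>Basis. q (r x) + 2 * k * q' (r x) * (y \<bullet> b)\<^sup>2)
        = N * q (r x) + 2 * k * q' (r x) * (norm y)\<^sup>2"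
      unfolding sum.distrib sum_distrib_left[symmetric] power2_norm_eq_inner
        euclidean_inner[of y y]
      by (simp add: N power2_eq_square)
    also have "\<dots> = g (r x) powr p"
      using ode[of "r x"] r_mem[of x] x ball(3) by (auto simp: r_def y_def mult_ac)
    finally have "- laplacian (ball c R) u x = A powr p * g (r x) powr p"
      by (simp flip: Ak)
    then show ?thesis
      using A pos[of "r x"] r_mem[of x] x ball(3) by (auto simp: u_def powr_mult)
  qed
  have robin: "dir_deriv (closure (ball c R)) u (outward_normal_ball c R x) x + \<beta> * u x = 0"
    if "x \<in> frontier (ball c R)" for x
  proof -
    have x: "norm (x - c) = R" "x \<in> cball c R"
      using that R by (auto simp: dist_norm norm_minus_commute)
    have rx: "r x = S" using x R by (simp add: r_def k_def)
    have "(x - c) \<bullet> outward_normal_ball c R x = R"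
      using x R by (simp add: outward_normal_ball_def power2_norm_eq_inner[symmetric] power2_eq_square)
    then have "dir_deriv (cball c R) u (outward_normal_ball c R x) x = - A * k * (q S * R)"
      using dir_deriv_eq[OF cball x(2) der_u[OF order_refl x(2)]] by (simp add: d_def rx)
    also have "\<dots> = - A * (S * q S) / R" using R by (simp add: k_def power2_eq_square)
    also have "\<dots> = - \<beta> * u x" using S R by (simp add: u_def rx)
    finally show ?thesis using R by simp
  qed
  have "positive_robin_solution (ball c R) (outward_normal_ball c R) p \<beta> u"
    unfolding positive_robin_solution_def
    using C2 C1 lap robin A pos r_mem ball(3) by (auto simp: u_def)
  then show ?thesis by (simp add: u_def[abs_def] A_def r_def)
qed

theorem theorem1p4:
  fixes c :: "real ^ 'n" and R p \<beta> :: real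
  assumes "CARD('n) \<ge> 3"
    and "p > (real CARD('n) + 2) / (real CARD('n) - 2)"
    and "R > 0"
    and "0 < \<beta>" and "\<beta> * R < 2 / (p - 1)"
  shows "\<exists>u. positive_robin_solution (ball c R) (outward_normal_ball c R) p \<beta> u \<and>
             radial_on (closure (ball c R)) c u"
proof -
  have "1 < (real CARD('n) + 2) / (real CARD('n) - 2)" using assms(1) by (simp add: field_simps)
  then have p: "1 < p" using assms(2) by linarith
  have N: "1 \<le> CARD('n)" using assms(1) by simp
  have b: "0 < \<beta> * R" using assms by simp
  obtain S :: real and q g q' :: "real \<Rightarrow> real" where
    "0 < S" "S * q S = \<beta> * R * g S" "\<And>s. s \<in> {0..S} \<Longrightarrow> 0 < g s"
    "\<And>s. s \<in> {0..S} \<Longrightarrow> (g has_real_derivative - q s / 2) (at s within {0..S})"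
    "\<And>s. s \<in> {0..S} \<Longrightarrow> (q has_real_derivative q' s) (at s within {0..S})"
    "continuous_on {0..S} q'"
    "\<And>s. s \<in> {0..S} \<Longrightarrow> CARD('n) * q s + 2 * s * q' s = g s powr p"
    by (rule radial_profile[OF N p b assms(5)]) (rule that)
  then have "positive_robin_solution (ball c R) (outward_normal_ball c R) p \<beta>
      (\<lambda>x. (S / R\<^sup>2) powr (1 / (p - 1)) * g (S / R\<^sup>2 * (norm (x - c))\<^sup>2))"
    using p assms(3) by (intro radial_solution_of_profile[where N = "CARD('n)"]) auto
  moreover have "radial_on (closure (ball c R)) c
      (\<lambda>x. (S / R\<^sup>2) powr (1 / (p - 1)) * g (S / R\<^sup>2 * (norm (x - c))\<^sup>2))"
    unfolding radial_on_def
    by (rule exI[of _ "\<lambda>t. (S / R\<^sup>2) powr (1 / (p - 1)) * g (S / R\<^sup>2 * t\<^sup>2)"]) simp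
  ultimately show ?thesis by blast
qed

end
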